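(* Let $\Sigma$ be a symmetric positive definite $n\times n$ matrix with $\Sigma_{i,i}=1$ for all $i$ and $\Sigma_{i,j}\in(-1,1)$ for $i\ne j$. Let $\mu_\Sigma$ be an elliptical distribution on $\mathbb{R}^n$ with matrix parameter $\Sigma$, i.e. a probability measure with density $x\mapsto Z_\Sigma^{-1}g(\|x\|_{\Sigma^{-1}})$ for some positive univariate function $g$, and let $\mu_{\mathrm{Id}}$ be the corresponding spherical distribution, with density $x\mapsto Z_{\mathrm{Id}}^{-1}g(\|x\|)$ ($Z_\Sigma,Z_{\mathrm{Id}}$ being normalization constants). Suppose that $\mu_{\mathrm{Id}}$ satisfies a weighted Poincaré inequality with weight $W_{\mathrm{Id}}(x)=w(\|x\|)\,\mathrm{Id}$, where $w:(0,\infty)\to(0,\infty)$, with optimal constant $C_P(\mu_{\mathrm{Id}},W_{\mathrm{Id}})$. Then $\mu_\Sigma$ satisfies the inequality $$\mathrm{Var}_{\mu_\Sigma}(f)\le C_P(\mu_{\mathrm{Id}},W_{\mathrm{Id}})\int_{\mathbb{R}^n}w\big(\|x\|_{\Sigma^{-1}}\big)\,\|\nabla f(x)\|_\Sigma^2\,d\mu_\Sigma(x)$$ for all $f\in L^2(\mu_\Sigma)$ for which the right-hand side is finite, and the constant $C_P(\mu_{\mathrm{Id}},W_{\mathrm{Id}})$ is optimal (the smallest possible) in this inequality.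
   Context: For a symmetric positive definite matrix $A$, $\|x\|_A=\sqrt{\langle Ax,x\rangle}$, and $\|\cdot\|$ is the Euclidean norm. A weight on an open set $\Omega\subset\mathbb{R}^n$ is a (measurable) function $W$ from $\Omega$ to the symmetric positive definite $n\times n$ matrices (here the weights may be left undefined at the single point $x=0$, which is negligible). A probability measure $\mu$ on a connected open set $\Omega$, with positive Lebesgue density there, satisfies a weighted Poincaré inequality with weight $W$ and finite constant $C>0$ if $$\mathrm{Var}_\mu(f):=\int_\Omega f^2\,d\mu-\Big(\int_\Omega f\,d\mu\Big)^2\le C\int_\Omega\|\nabla f\|_W^2\,d\mu$$ for all $f\in L^2(\mu)$ for which the right-hand side is finite, where $\nabla f$ is the gradient of weak partial derivatives (so $f$ is understood to be weakly differentiable). $C_P(\mu,W)$ denotes the smallest such constant. *)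

theory Defs
  imports "HOL-Analysis.Analysis" "HOL-Probability.Probability"
begin

section \<open>Matrices and matrix norms\<close>

definition sym_pos_def :: "real^'n^'n \<Rightarrow> bool" where
  "sym_pos_def A \<longleftrightarrow> transpose A = A \<and> (\<forall>x. x \<noteq> 0 \<longrightarrow> (A *v x) \<bullet> x > 0)"

definition mat_norm :: "real^'n^'n \<Rightarrow> real^'n \<Rightarrow> real" where
  "mat_norm A x = sqrt ((A *v x) \<bullet> x)"

section \<open>Weak gradients on the whole space\<close>

definition partial_deriv :: "'n \<Rightarrow> (real^'n \<Rightarrow> real) \<Rightarrow> real^'n \<Rightarrow> real" where
  "partial_deriv i f x = frechet_derivative f (at x) (axis i 1)"

primrec times_cont_diff :: "nat \<Rightarrow> (real^'n \<Rightarrow> real) \<Rightarrow> bool" where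
  "times_cont_diff 0 f \<longleftrightarrow> continuous_on UNIV f"
| "times_cont_diff (Suc k) f \<longleftrightarrow>
     (\<forall>x. f differentiable (at x)) \<and> (\<forall>i. times_cont_diff k (partial_deriv i f))"

definition test_function :: "(real^'n \<Rightarrow> real) \<Rightarrow> bool" where
  "test_function \<phi> \<longleftrightarrow> (\<forall>k. times_cont_diff k \<phi>) \<and> compact (closure {x. \<phi> x \<noteq> 0})"

definition locally_integrable :: "(real^'n \<Rightarrow> real) \<Rightarrow> bool" where
  "locally_integrable f \<longleftrightarrow>
     f \<in> borel_measurable borel \<and> (\<forall>K. compact K \<longrightarrow> set_integrable lborel K f)"

definition weak_gradient :: "(real^'n \<Rightarrow> real) \<Rightarrow> (real^'n \<Rightarrow> real^'n) \<Rightarrow> bool" where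
  "weak_gradient f F \<longleftrightarrow>
     locally_integrable f \<and>
     (\<forall>i. locally_integrable (\<lambda>x. F x $ i) \<and>
       (\<forall>\<phi>. test_function \<phi> \<longrightarrow>
         (\<integral>x. f x * partial_deriv i \<phi> x \<partial>lborel) = - (\<integral>x. F x $ i * \<phi> x \<partial>lborel)))"

section \<open>Weighted Poincare inequalities\<close>

definition square_integrable :: "'a measure \<Rightarrow> ('a \<Rightarrow> real) \<Rightarrow> bool" where
  "square_integrable M f \<longleftrightarrow> f \<in> borel_measurable M \<and> integrable M (\<lambda>x. (f x)\<^sup>2)"

definition Var :: "'a measure \<Rightarrow> ('a \<Rightarrow> real) \<Rightarrow> real" where
  "Var M f = (\<integral>x. (f x)\<^sup>2 \<partial>M) - (\<integral>x. f x \<partial>M)\<^sup>2"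

text \<open>
  The inequality with constant \<open>C\<close> and right-hand side \<open>\<integral> e x (\<nabla>f x) d\<mu>\<close>. For a
  nonnegative measurable integrand, integrability says exactly that this integral is finite.
\<close>
definition poincare_ineq ::
    "(real^'n) measure \<Rightarrow> (real^'n \<Rightarrow> real^'n \<Rightarrow> real) \<Rightarrow> real \<Rightarrow> bool" where
  "poincare_ineq M e C \<longleftrightarrow>
     (\<forall>f F. square_integrable M f \<and> weak_gradient f F \<and> integrable M (\<lambda>x. e x (F x)) \<longrightarrow>
        Var M f \<le> C * (\<integral>x. e x (F x) \<partial>M))"

definition weighted_poincare ::
    "(real^'n) measure \<Rightarrow> (real^'n \<Rightarrow> real^'n^'n) \<Rightarrow> real \<Rightarrow> bool" where
  "weighted_poincare M W C \<longleftrightarrow> C > 0 \<and> poincare_ineq M (\<lambda>x v. (mat_norm (W x) v)\<^sup>2) C"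

text \<open>
  The set of admissible constants is upward closed and its infimum again satisfies the
  inequality (let \<open>C\<close> decrease to it for each fixed \<open>f\<close>), so whenever some constant is
  admissible the infimum is the smallest constant in the inequality.
\<close>
definition poincare_const :: "(real^'n) measure \<Rightarrow> (real^'n \<Rightarrow> real^'n^'n) \<Rightarrow> real" where
  "poincare_const M W = Inf {C. weighted_poincare M W C}"

section \<open>Elliptical and spherical distributions\<close>

text \<open>
  If \<open>h\<close> is not Borel measurable and integrable, the normalization constant is \<open>0\<close> and the
  result is the zero measure; requiring \<open>prob_space\<close> of it therefore includes
  integrability of \<open>h\<close>.
\<close>
definition normalized_density :: "(real^'n \<Rightarrow> real) \<Rightarrow> (real^'n) measure" where
  "normalized_density h = density lborel (\<lambda>x. ennreal (h x / (\<integral>y. h y \<partial>lborel)))"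

definition elliptical :: "(real \<Rightarrow> real) \<Rightarrow> real^'n^'n \<Rightarrow> (real^'n) measure" where
  "elliptical g S = normalized_density (\<lambda>x. g (mat_norm (matrix_inv S) x))"

definition spherical :: "(real \<Rightarrow> real) \<Rightarrow> (real^'n) measure" where
  "spherical g = normalized_density (\<lambda>x. g (norm x))"

end

theory Submission imports Defs begin

text \<open>
  An elliptical distribution is a linear image of the corresponding spherical one, and a linear
  map carries the one Poincare inequality into the other without loss.

  Factor \<open>\<Sigma> = A A\<^sup>T\<close> with \<open>A\<close> invertible. Then \<open>\<Sigma>\<^sup>-\<^sup>1 = B\<^sup>T B\<close> for \<open>B = A\<^sup>-\<^sup>1\<close>, so the norm of
  \<open>A y\<close> with respect to \<open>\<Sigma>\<^sup>-\<^sup>1\<close> is the Euclidean norm of \<open>y\<close>, and \<open>\<mu>\<^sub>\<Sigma>\<close> is the image of the spherical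
  measure under \<open>y \<mapsto> A y\<close> (\<open>normalized_density_distr\<close>). If \<open>f\<close> has weak gradient \<open>F\<close>, then
  \<open>y \<mapsto> f (A y)\<close> has weak gradient \<open>y \<mapsto> A\<^sup>T F (A y)\<close> (\<open>weak_gradient_matrix_compose\<close>), and the squared
  Euclidean norm of \<open>A\<^sup>T v\<close> is \<open>\<langle>\<Sigma> v, v\<rangle>\<close>. So variance and energy of \<open>f\<close> under \<open>\<mu>\<^sub>\<Sigma>\<close> equal those of
  \<open>y \<mapsto> f (A y)\<close> under the spherical measure. As \<open>B\<close> gives the reverse passage, the two
  inequalities hold for exactly the same constants (\<open>poincare_ineq_linear_image\<close>), hence
  with the same least one.

  The analytic content is the chain rule for weak gradients, which comes down to a linear change
  of variables in the defining integrals against test functions. An invertible linear map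
  scales Lebesgue measure by some positive constant (\<open>distr_lborel_linear\<close>); this constant occurs
  on both sides of every identity and cancels, whatever its value.
\<close>

section \<open>Factorization of a positive definite matrix\<close>

text \<open>
  Gram--Schmidt for the inner product \<open>\<langle>S x, y\<rangle>\<close>: as long as the index set is not exhausted, the
  span of the vectors found so far is a proper subspace, and a vector outside of it yields the
  next one after projection and normalization.
\<close>

lemma sym_pos_def_orthonormal_family:
  fixes S :: "real^'n^'n"
  assumes S: "sym_pos_def S" and "finite I"
  shows "\<exists>t :: 'n \<Rightarrow> real^'n. \<forall>i\<in>I. \<forall>j\<in>I. (S *v t i) \<bullet> t j = (if i = j then 1 else 0)"
  using \<open>finite I\<close>
proof (induction I)
  case empty
  then show ?case by simp
next
  case (insert k I)
  have sym: "(S *v x) \<bullet> y = (S *v y) \<bullet> x" for x y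
    using S unfolding sym_pos_def_def
    by (metis dot_lmul_matrix inner_commute transpose_matrix_vector)
  from insert.IH obtain t :: "'n \<Rightarrow> real^'n"
    where t: "\<And>i j. i \<in> I \<Longrightarrow> j \<in> I \<Longrightarrow> (S *v t i) \<bullet> t j = (if i = j then 1 else 0)"
    by blast
  have "dim (t ` I) \<le> card I"
    using dim_le_card'[of "t ` I"] card_image_le[of I t] insert.hyps by auto
  also have "card I < CARD('n)"
    using insert.hyps by (metis UNIV_I finite_class.finite_UNIV psubset_card_mono psubsetI subset_UNIV)
  finally have "span (t ` I) \<noteq> UNIV"
    using dim_span[of "t ` I"] by (metis DIM_cart DIM_real dim_UNIV mult.right_neutral order_less_irrefl)
  then obtain x where x: "x \<notin> span (t ` I)" by blast
  define y where "y = x - (\<Sum>i\<in>I. ((S *v t i) \<bullet> x) *\<^sub>R t i)"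
  have orth: "(S *v t j) \<bullet> y = 0" if "j \<in> I" for j
  proof -
    have "(S *v t j) \<bullet> y = (S *v t j) \<bullet> x - (\<Sum>i\<in>I. ((S *v t i) \<bullet> x) * (if j = i then 1 else 0))"
      unfolding y_def inner_diff_right inner_sum_right using t that by simp
    also have "\<dots> = 0"
      using that insert.hyps by (simp add: if_distrib cong: if_cong)
    finally show ?thesis .
  qed
  have "(\<Sum>i\<in>I. ((S *v t i) \<bullet> x) *\<^sub>R t i) \<in> span (t ` I)"
    by (intro span_sum span_scale span_base) auto
  with x have "y \<noteq> 0" unfolding y_def by auto
  then have pos: "(S *v y) \<bullet> y > 0"
    using S by (simp add: sym_pos_def_def)
  define z where "z = (1 / sqrt ((S *v y) \<bullet> y)) *\<^sub>R y"
  have z1: "(S *v z) \<bullet> z = 1"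
    using pos by (simp add: z_def matrix_vector_mult_scaleR field_simps flip: power2_eq_square)
  have z0: "(S *v t j) \<bullet> z = 0" "(S *v z) \<bullet> t j = 0" if "j \<in> I" for j
    using orth[OF that] sym[of z "t j"] by (simp_all add: z_def)
  show ?case
    using t z1 z0 insert.hyps by (intro exI[of _ "t(k := z)"]) auto
qed

text \<open>
  If the columns of \<open>Q\<close> are orthonormal for \<open>\<langle>S x, y\<rangle>\<close>, that is \<open>Q\<^sup>T S Q = 1\<close>, then \<open>A = S Q\<close> and
  \<open>B = Q\<^sup>T\<close> are inverse to each other, and \<open>A A\<^sup>T = S Q (Q\<^sup>T S) = S\<close>.
\<close>

lemma sym_pos_def_factorization:
  fixes S :: "real^'n^'n"
  assumes S: "sym_pos_def S"
  obtains A B :: "real^'n^'n"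
  where "A ** B = mat 1" "B ** A = mat 1" "S = A ** transpose A"
    "matrix_inv S = transpose B ** B"
proof -
  have [simp]: "transpose S = S" using S by (simp add: sym_pos_def_def)
  obtain t :: "'n \<Rightarrow> real^'n"
    where t: "\<And>i j. (S *v t i) \<bullet> t j = (if i = j then 1 else 0)"
    using sym_pos_def_orthonormal_family[OF S finite[of UNIV]] by auto
  define Q :: "real^'n^'n" where "Q = (\<chi> k i. t i $ k)"
  define A where "A = S ** Q"
  define B where "B = transpose Q"
  have col: "column i (S ** Q) = S *v t i" "row i (transpose Q) = t i" for i
    by (simp_all add: Q_def column_def row_def transpose_def matrix_matrix_mult_def
        matrix_vector_mult_def vec_eq_iff)
  have "(B ** A) $ i $ j = (mat 1 :: real^'n^'n) $ i $ j" for i j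
  proof -
    have "(B ** A) $ i $ j = row i B \<bullet> column j A"
      by (simp add: matrix_matrix_mult_def inner_vec_def row_def column_def)
    also have "\<dots> = (mat 1 :: real^'n^'n) $ i $ j"
      unfolding A_def B_def col by (subst inner_commute) (simp add: t mat_def eq_commute[of j i])
    finally show ?thesis .
  qed
  then have BA: "B ** A = mat 1" by (simp add: vec_eq_iff)
  then have AB: "A ** B = mat 1" by (simp add: matrix_left_right_inverse)
  have AT: "transpose A = B ** S"
    by (simp add: A_def B_def matrix_transpose_mul)
  have fact: "S = A ** transpose A"
    by (simp add: AT AB matrix_mul_assoc)
  have "S ** (transpose B ** B) = A ** (transpose A ** transpose B) ** B"
    by (subst fact) (simp add: matrix_mul_assoc)
  also have "\<dots> = mat 1"
    by (simp flip: matrix_transpose_mul add: BA AB)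
  finally have inv1: "S ** (transpose B ** B) = mat 1" .
  then have inv2: "(transpose B ** B) ** S = mat 1" by (simp add: matrix_left_right_inverse)
  have "S ** matrix_inv S = mat 1"
    unfolding matrix_inv_def by (rule someI2[of _ "transpose B ** B"]) (use inv1 inv2 in auto)
  then have "matrix_inv S = transpose B ** B"
    by (metis inv2 matrix_mul_assoc matrix_mul_lid matrix_mul_rid)
  with AB BA fact that show thesis by blast
qed

section \<open>Lebesgue measure under an invertible linear map\<close>

lemma nn_integral_lborel_translate:
  fixes f :: "'a::euclidean_space \<Rightarrow> ennreal"
  assumes [measurable]: "f \<in> borel_measurable borel"
  shows "(\<integral>\<^sup>+x. f (a + x) \<partial>lborel) = (\<integral>\<^sup>+x. f x \<partial>lborel)"
  by (subst (2) lborel_distr_plus[of a, symmetric]) (simp add: nn_integral_distr)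

text \<open>
  This is the uniqueness argument for Haar measure, applied to \<open>\<nu>\<close>, the image of Lebesgue measure
  \<open>\<lambda>\<close> under \<open>L\<close>. For a symmetric set \<open>B\<close>, here the unit ball, the quantity
  \<open>\<integral>\<integral> 1\<^sub>A(x) 1\<^sub>B(y - x) \<lambda>(dy) \<nu>(dx)\<close> is \<open>\<nu>(A) \<lambda>(B)\<close> by translation invariance of \<open>\<lambda>\<close>; exchanging
  the integrals and translating \<open>x\<close> by \<open>y\<close> under \<open>\<nu>\<close> turns it into \<open>\<lambda>(A) \<nu>(B)\<close>. Hence the scaling
  constant is \<open>\<nu>(B) / \<lambda>(B)\<close>, with both numbers finite and positive.
\<close>

lemma distr_lborel_linear:
  fixes L K :: "'a::euclidean_space \<Rightarrow> 'a"
  assumes L: "linear L" and K: "linear K" and LK: "\<And>x. L (K x) = x" and KL: "\<And>x. K (L x) = x"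
  obtains c :: real where "c > 0" "distr lborel borel L = density lborel (\<lambda>_. ennreal c)"
proof -
  have [measurable]: "L \<in> borel_measurable borel" "K \<in> borel_measurable borel"
    using L K by (simp_all add: borel_measurable_continuous_onI linear_continuous_on linear_linear)
  interpret L: linear L by fact
  define B :: "'a set" where "B = ball 0 1"
  have [measurable]: "B \<in> sets borel" by (simp add: B_def)
  define b where "b = emeasure lborel B"
  have imL: "L -` B = K ` B"
    using LK KL by (auto simp: image_iff) metis
  have B: "open B" "B \<noteq> {}" "bounded B" "- x \<in> B \<longleftrightarrow> x \<in> B" for x by (auto simp: B_def)
  have KB: "open (L -` B)" "L -` B \<noteq> {}" "bounded (K ` B)"
    using B K linear_continuous_on[of L UNIV] L LK
    by (auto simp: linear_linear open_vimage bounded_linear_image intro!: exI[of _ 0])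
  have pos: "emeasure lborel U \<noteq> 0" if "open U" "U \<noteq> {}" for U :: "'a set"
  proof
    assume "emeasure lborel U = 0"
    then have "negligible U"
      using that by (auto simp: negligible_iff_null_sets null_sets_def)
    then show False using that open_not_negligible by blast
  qed
  have fin: "emeasure lborel U < \<infinity>" if "bounded U" for U :: "'a set"
    using that by (rule emeasure_bounded_finite)
  define m where "m = emeasure lborel (L -` B)"
  have b: "b \<noteq> 0" "b < \<infinity>" unfolding b_def using pos B fin by auto
  have m: "m \<noteq> 0" "m < \<infinity>" unfolding m_def using pos[OF KB(1,2)] fin[OF KB(3)] imL by auto
  have "m = emeasure (distr lborel borel L) B"
    by (simp add: m_def emeasure_distr)
  also have "\<dots> = (\<integral>\<^sup>+x. indicator B x \<partial>distr lborel borel L)"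
    by simp
  also have "\<dots> = (\<integral>\<^sup>+x. indicator B (L x) \<partial>lborel)"
    by (subst nn_integral_distr) simp_all
  finally have mB: "m = (\<integral>\<^sup>+x. indicator B (L x) \<partial>lborel)" .
  have key: "emeasure (distr lborel borel L) A * b = emeasure lborel A * m"
    if [measurable]: "A \<in> sets borel" for A
  proof -
    have "emeasure (distr lborel borel L) A = (\<integral>\<^sup>+x. indicator A x \<partial>distr lborel borel L)"
      by simp
    also have "\<dots> = (\<integral>\<^sup>+x. indicator A (L x) \<partial>lborel)"
      by (subst nn_integral_distr) simp_all
    finally have "emeasure (distr lborel borel L) A * b = (\<integral>\<^sup>+x. indicator A (L x) * b \<partial>lborel)"
      by (simp add: nn_integral_multc)
    also have "\<dots> = (\<integral>\<^sup>+x. \<integral>\<^sup>+y. indicator A (L x) * indicator B (y - L x) \<partial>lborel \<partial>lborel)"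
    proof (rule nn_integral_cong)
      fix x
      have "(\<integral>\<^sup>+y. indicator B (y - L x) \<partial>lborel) = b"
        using nn_integral_lborel_translate[of "indicator B" "- L x"] by (simp add: b_def)
      then show "indicator A (L x) * b = (\<integral>\<^sup>+y. indicator A (L x) * indicator B (y - L x) \<partial>lborel)"
        by (simp add: nn_integral_cmult)
    qed
    also have "\<dots> = (\<integral>\<^sup>+y. \<integral>\<^sup>+x. indicator A (L x) * indicator B (y - L x) \<partial>lborel \<partial>lborel)"
      by (rule lborel_pair.Fubini'[symmetric]) measurable
    \<comment> \<open>Substitute \<open>K y + x\<close> for \<open>x\<close>; the symmetry of the ball absorbs the sign of \<open>- L x\<close>.\<close>
    also have "\<dots> = (\<integral>\<^sup>+y. \<integral>\<^sup>+x. indicator A (L x + y) * indicator B (L x) \<partial>lborel \<partial>lborel)"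
    proof (rule nn_integral_cong)
      fix y
      have "(\<integral>\<^sup>+x. indicator A (L x) * indicator B (y - L x) \<partial>lborel) =
        (\<integral>\<^sup>+x. indicator A (L (K y + x)) * indicator B (y - L (K y + x)) \<partial>lborel :: ennreal)"
        by (subst nn_integral_lborel_translate[of
            "\<lambda>x. indicator A (L x) * indicator B (y - L x)" "K y"]) simp_all
      also have "\<dots> = (\<integral>\<^sup>+x. indicator A (L x + y) * indicator B (L x) \<partial>lborel)"
        by (simp add: L.add LK indicator_def B add.commute)
      finally show "(\<integral>\<^sup>+x. indicator A (L x) * indicator B (y - L x) \<partial>lborel) =
        (\<integral>\<^sup>+x. indicator A (L x + y) * indicator B (L x) \<partial>lborel :: ennreal)" .
    qed
    also have "\<dots> = (\<integral>\<^sup>+x. \<integral>\<^sup>+y. indicator A (L x + y) * indicator B (L x) \<partial>lborel \<partial>lborel)"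
      by (rule lborel_pair.Fubini') measurable
    also have "\<dots> = (\<integral>\<^sup>+x. emeasure lborel A * indicator B (L x) \<partial>lborel)"
      by (simp add: nn_integral_multc nn_integral_lborel_translate)
    also have "\<dots> = emeasure lborel A * m"
      by (simp add: mB nn_integral_cmult)
    finally show ?thesis .
  qed
  obtain b' m' where "b = ennreal b'" "m = ennreal m'" "b' > 0" "m' > 0"
    using b m by (cases b; cases m) (auto simp: less_le)
  then obtain c where c: "ennreal c = m / b" "c > 0"
    using divide_ennreal[of m' b'] divide_pos_pos[of m' b'] by (metis less_imp_le)
  have "distr lborel borel L = density lborel (\<lambda>_. ennreal c)"
  proof (rule measure_eqI)
    fix A assume "A \<in> sets (distr lborel borel L)"
    then have [measurable]: "A \<in> sets borel" by simp
    have "emeasure (distr lborel borel L) A = emeasure (distr lborel borel L) A * b / b"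
      using b by (simp add: ennreal_mult_divide_eq)
    also have "\<dots> = ennreal c * emeasure lborel A"
      unfolding key[OF \<open>A \<in> sets borel\<close>] c
      by (simp add: divide_ennreal_def mult_ac)
    finally show "emeasure (distr lborel borel L) A = emeasure (density lborel (\<lambda>_. ennreal c)) A"
      by (simp add: emeasure_density nn_integral_cmult)
  qed simp
  with c that show thesis by blast
qed

lemma distr_lborel_matrix:
  fixes A B :: "real^'n^'n"
  assumes "A ** B = mat 1" "B ** A = mat 1"
  obtains c :: real where "c > 0" "distr lborel borel ((*v) A) = density lborel (\<lambda>_. ennreal c)"
  by (rule distr_lborel_linear[of "(*v) A" "(*v) B"]) (simp_all add: matrix_vector_mul_assoc assms)

lemma borel_measurable_matrix_vector_mult [measurable]:
  "(*v) (A :: real^'n^'m) \<in> borel_measurable borel"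
  by (intro borel_measurable_continuous_onI linear_continuous_on) (simp add: linear_linear)

lemma lborel_integral_linear_substitution:
  fixes f :: "real^'n \<Rightarrow> real"
  assumes D: "distr lborel borel ((*v) A) = density lborel (\<lambda>_. ennreal c)" and c: "c > 0"
    and [measurable]: "f \<in> borel_measurable borel"
  shows "(\<integral>x. f (A *v x) \<partial>lborel) = c * (\<integral>x. f x \<partial>lborel)"
    and "integrable lborel (\<lambda>x. f (A *v x)) \<longleftrightarrow> integrable lborel f"
proof -
  have "(\<integral>x. f (A *v x) \<partial>lborel) = (\<integral>x. f x \<partial>distr lborel borel ((*v) A))"
    by (simp add: integral_distr)
  also have "\<dots> = c * (\<integral>x. f x \<partial>lborel)"
    using c by (simp add: D integral_density)
  finally show "(\<integral>x. f (A *v x) \<partial>lborel) = c * (\<integral>x. f x \<partial>lborel)" .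
  have "integrable lborel (\<lambda>x. f (A *v x)) \<longleftrightarrow> integrable (distr lborel borel ((*v) A)) f"
    by (simp add: integrable_distr_eq)
  also have "\<dots> \<longleftrightarrow> integrable lborel f"
    using c by (simp add: D integrable_density)
  finally show "integrable lborel (\<lambda>x. f (A *v x)) \<longleftrightarrow> integrable lborel f" .
qed

section \<open>Test functions\<close>

text \<open>
  A partial derivative of \<open>x \<mapsto> f (A x)\<close> is a linear combination of functions of the same form,
  so smoothness of compositions needs an induction on the order with linear combinations included.
\<close>

lemma partial_deriv_sum:
  assumes "\<And>j. j \<in> I \<Longrightarrow> f j differentiable (at x)"
  shows "partial_deriv i (\<lambda>x. \<Sum>j\<in>I. a j * f j x) x = (\<Sum>j\<in>I. a j * partial_deriv i (f j) x)"
proof -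
  have "((\<lambda>x. \<Sum>j\<in>I. a j * f j x) has_derivative
      (\<lambda>h. \<Sum>j\<in>I. a j * frechet_derivative (f j) (at x) h)) (at x)"
    by (intro has_derivative_sum has_derivative_mult_right)
      (rule iffD1[OF frechet_derivative_works assms])
  from frechet_derivative_at[OF this, symmetric] show ?thesis
    by (simp add: partial_deriv_def)
qed

lemma times_cont_diff_sum:
  assumes "\<And>j. j \<in> I \<Longrightarrow> times_cont_diff k (f j)"
  shows "times_cont_diff k (\<lambda>x. \<Sum>j\<in>I. a j * f j x)"
  using assms
proof (induction k arbitrary: f)
  case 0
  then show ?case by (auto intro!: continuous_intros)
next
  case (Suc k)
  then have d: "\<And>j x. j \<in> I \<Longrightarrow> f j differentiable (at x)"
    by simp
  have eq: "partial_deriv i (\<lambda>x. \<Sum>j\<in>I. a j * f j x) =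
      (\<lambda>x. \<Sum>j\<in>I. a j * partial_deriv i (f j) x)" for i
    using d by (auto intro!: ext partial_deriv_sum)
  have "times_cont_diff k (partial_deriv i (\<lambda>x. \<Sum>j\<in>I. a j * f j x))" for i
    unfolding eq by (rule Suc.IH) (use Suc.prems in auto)
  moreover have "(\<lambda>x. \<Sum>j\<in>I. a j * f j x) differentiable (at x)" for x
    using d by (cases "finite I") (simp_all add: differentiable_sum differentiable_mult)
  ultimately show ?case by simp
qed

lemma partial_deriv_matrix_compose:
  fixes A :: "real^'n^'n"
  assumes "f differentiable (at (A *v x))"
  shows "(\<lambda>x. f (A *v x)) differentiable (at x)"
    and "partial_deriv i (\<lambda>x. f (A *v x)) x = (\<Sum>j\<in>UNIV. A $ j $ i * partial_deriv j f (A *v x))"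
proof -
  define D where "D = frechet_derivative f (at (A *v x))"
  have D: "(f has_derivative D) (at (A *v x))"
    unfolding D_def by (rule iffD1[OF frechet_derivative_works assms])
  then interpret D: linear D by (rule has_derivative_linear)
  have "((\<lambda>x. f (A *v x)) has_derivative (\<lambda>h. D (A *v h))) (at x)"
    by (rule has_derivative_compose[of "(*v) A" "(*v) A" x UNIV f D,
          OF bounded_linear_imp_has_derivative D])
      (rule matrix_vector_mul_bounded_linear)
  note * = this
  show "(\<lambda>x. f (A *v x)) differentiable (at x)"
    using * by (auto simp: differentiable_def)
  have col: "column i A = (\<Sum>j\<in>UNIV. A $ j $ i *\<^sub>R axis j 1)"
    using basis_expansion[of "column i A"] by (simp add: column_def scalar_mult_eq_scaleR)
  have "partial_deriv i (\<lambda>x. f (A *v x)) x = D (A *v axis i 1)"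
    unfolding partial_deriv_def by (simp add: frechet_derivative_at[OF *, symmetric])
  also have "\<dots> = (\<Sum>j\<in>UNIV. A $ j $ i * D (axis j 1))"
    by (simp add: matrix_vector_mult_basis col D.sum D.scale)
  finally show "partial_deriv i (\<lambda>x. f (A *v x)) x =
      (\<Sum>j\<in>UNIV. A $ j $ i * partial_deriv j f (A *v x))"
    by (simp add: D_def partial_deriv_def)
qed

lemma times_cont_diff_matrix_compose:
  fixes A :: "real^'n^'n"
  shows "times_cont_diff k f \<Longrightarrow> times_cont_diff k (\<lambda>x. f (A *v x))"
proof (induction k arbitrary: f)
  case 0
  then have "continuous_on UNIV (f \<circ> (*v) A)"
    by (intro continuous_on_compose[OF linear_continuous_on[OF matrix_vector_mul_bounded_linear]])
      (auto intro: continuous_on_subset)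
  then show ?case by (simp add: o_def)
next
  case (Suc k)
  then have d: "\<And>x. f differentiable (at x)" and
    p: "\<And>j. times_cont_diff k (\<lambda>x. partial_deriv j f (A *v x))"
    by auto
  have "partial_deriv i (\<lambda>x. f (A *v x)) =
      (\<lambda>x. \<Sum>j\<in>UNIV. A $ j $ i * partial_deriv j f (A *v x))" for i
    using d by (auto intro!: ext partial_deriv_matrix_compose)
  with p d show ?case
    by (simp add: partial_deriv_matrix_compose times_cont_diff_sum)
qed

lemma test_function_matrix_compose:
  fixes A B :: "real^'n^'n"
  assumes inv: "A ** B = mat 1" "B ** A = mat 1" and f: "test_function f"
  shows "test_function (\<lambda>x. f (A *v x))"
proof -
  let ?K = "closure {x. f x \<noteq> 0}"
  have compact: "compact ((*v) B ` ?K)"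
    using f by (auto simp: test_function_def intro!: compact_continuous_image linear_continuous_on
        simp: linear_linear)
  have "x \<in> (*v) B ` ?K" if "f (A *v x) \<noteq> 0" for x
  proof
    show "x = B *v (A *v x)" by (simp add: matrix_vector_mul_assoc inv)
    show "A *v x \<in> ?K" using that closure_subset[of "{x. f x \<noteq> 0}"] by auto
  qed
  then have "closure {x. f (A *v x) \<noteq> 0} \<subseteq> (*v) B ` ?K"
    using compact by (intro closure_minimal compact_imp_closed) auto
  with compact have "compact (closure {x. f (A *v x) \<noteq> 0})"
    by (meson bounded_subset closed_closure compact_eq_bounded_closed)
  with f show ?thesis
    by (simp add: test_function_def times_cont_diff_matrix_compose)
qed

lemma test_function_continuous:
  assumes "test_function f"
  shows "continuous_on UNIV f" "continuous_on UNIV (partial_deriv i f)"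
proof -
  show "continuous_on UNIV f"
    using assms times_cont_diff.simps(1) unfolding test_function_def by blast
  have "times_cont_diff (Suc 0) f" using assms unfolding test_function_def by blast
  then show "continuous_on UNIV (partial_deriv i f)" by simp
qed

lemma test_function_zero_outside:
  assumes f: "test_function f" and x: "x \<notin> closure {x. f x \<noteq> 0}"
  shows "f x = 0" "partial_deriv i f x = 0"
proof -
  let ?U = "- closure {x. f x \<noteq> 0}"
  have zero: "f y = 0" if "y \<in> ?U" for y
    using that closure_subset[of "{x. f x \<noteq> 0}"] by auto
  show "f x = 0" by (rule zero) (use x in simp)
  have "frechet_derivative (\<lambda>_. 0) (at x) = frechet_derivative f (at x)"
  proof (rule frechet_derivative_transform_within_open[of _ _ ?U])
    show "x \<in> ?U" using x by simp
    show "0 = f y" if "y \<in> ?U" for y using zero[OF that] by (rule sym)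
  qed auto
  then show "partial_deriv i f x = 0"
    unfolding partial_deriv_def by (metis frechet_derivative_const)
qed

section \<open>Local integrability and weak gradients\<close>

text \<open>
  The integrals that define weak gradients exist, which is what allows them to be split over the
  coordinates after a change of variables.
\<close>

lemma integrable_locally_integrable_mult:
  assumes f: "locally_integrable f" and p: "continuous_on UNIV p" and K: "compact K"
    and zero: "\<And>x. x \<notin> K \<Longrightarrow> p x = 0"
  shows "integrable lborel (\<lambda>x. f x * p x)"
proof -
  have "compact (p ` K)"
    using p K by (intro compact_continuous_image) (auto intro: continuous_on_subset)
  then obtain M where M: "\<And>x. x \<in> K \<Longrightarrow> \<bar>p x\<bar> \<le> M"
    by (metis compact_imp_bounded bounded_iff imageI real_norm_def)
  have [measurable]: "f \<in> borel_measurable borel" "p \<in> borel_measurable borel"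
    using f p by (auto simp: locally_integrable_def borel_measurable_continuous_onI)
  have "integrable lborel (\<lambda>x. M * (indicator K x *\<^sub>R f x))"
    using f K by (intro integrable_mult_right) (auto simp: locally_integrable_def set_integrable_def)
  then show ?thesis
  proof (rule Bochner_Integration.integrable_bound)
    show "AE x in lborel. norm (f x * p x) \<le> norm (M * (indicator K x *\<^sub>R f x))"
    proof (rule AE_I2)
      fix x
      show "norm (f x * p x) \<le> norm (M * (indicator K x *\<^sub>R f x))"
      proof (cases "x \<in> K")
        case True
        then have "\<bar>f x\<bar> * \<bar>p x\<bar> \<le> \<bar>f x\<bar> * \<bar>M\<bar>"
          using M[of x] by (intro mult_left_mono) auto
        with True show ?thesis by (simp add: abs_mult mult.commute)
      qed (simp add: zero)
    qed
  qed simp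
qed

lemma integrable_weak_gradient_pairing:
  assumes "locally_integrable f" "test_function p"
  shows "integrable lborel (\<lambda>x. f x * p x)" "integrable lborel (\<lambda>x. f x * partial_deriv i p x)"
proof -
  have K: "compact (closure {x. p x \<noteq> 0})" using assms(2) by (simp add: test_function_def)
  show "integrable lborel (\<lambda>x. f x * p x)"
    using test_function_zero_outside(1)[OF assms(2)]
    by (rule integrable_locally_integrable_mult[OF assms(1) test_function_continuous(1)[OF assms(2)] K])
  show "integrable lborel (\<lambda>x. f x * partial_deriv i p x)"
    using test_function_zero_outside(2)[OF assms(2)]
    by (rule integrable_locally_integrable_mult[OF assms(1) test_function_continuous(2)[OF assms(2)] K])
qed

lemma locally_integrable_sum:
  assumes "\<And>j. j \<in> I \<Longrightarrow> locally_integrable (f j)"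
  shows "locally_integrable (\<lambda>x. \<Sum>j\<in>I. a j * f j x)"
proof -
  have "set_integrable lborel K (\<lambda>x. \<Sum>j\<in>I. a j * f j x)" if "compact K" for K
  proof -
    have "integrable lborel (\<lambda>x. indicator K x *\<^sub>R f j x)" if "j \<in> I" for j
      using assms[OF that] \<open>compact K\<close> by (simp add: locally_integrable_def set_integrable_def)
    then have "integrable lborel (\<lambda>x. \<Sum>j\<in>I. a j * (indicator K x *\<^sub>R f j x))"
      by (intro Bochner_Integration.integrable_sum integrable_mult_right)
    then show ?thesis
      by (simp add: set_integrable_def sum_distrib_left mult.left_commute)
  qed
  moreover have "(\<lambda>x. \<Sum>j\<in>I. a j * f j x) \<in> borel_measurable borel"
    using assms unfolding locally_integrable_def
    by (intro borel_measurable_sum borel_measurable_times borel_measurable_const) blast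
  ultimately show ?thesis unfolding locally_integrable_def by blast
qed

lemma locally_integrable_matrix_compose:
  fixes A B :: "real^'n^'n"
  assumes inv: "A ** B = mat 1" "B ** A = mat 1" and f: "locally_integrable f"
  shows "locally_integrable (\<lambda>x. f (A *v x))"
proof -
  obtain c where c: "c > 0" and D: "distr lborel borel ((*v) A) = density lborel (\<lambda>_. ennreal c)"
    using distr_lborel_matrix[OF inv] by blast
  have [measurable]: "f \<in> borel_measurable borel" using f by (simp add: locally_integrable_def)
  have "set_integrable lborel K (\<lambda>x. f (A *v x))" if K: "compact K" for K
  proof -
    have "compact ((*v) A ` K)"
      using K by (auto intro!: compact_continuous_image linear_continuous_on simp: linear_linear)
    then have i: "integrable lborel (\<lambda>x. indicator ((*v) A ` K) x *\<^sub>R f x)"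
      and [measurable]: "(*v) A ` K \<in> sets borel"
      using f by (auto simp: locally_integrable_def set_integrable_def compact_imp_closed)
    have "A *v x \<in> (*v) A ` K \<longleftrightarrow> x \<in> K" for x
      by (metis (no_types, lifting) imageE imageI inv(2) matrix_vector_mul_assoc matrix_vector_mul_lid)
    then have ind: "indicator ((*v) A ` K) (A *v x) = (indicator K x :: real)" for x
      by (simp add: indicator_def)
    have "integrable lborel (\<lambda>x. indicator ((*v) A ` K) (A *v x) *\<^sub>R f (A *v x))"
      by (subst lborel_integral_linear_substitution(2)[OF D c,
            of "\<lambda>x. indicator ((*v) A ` K) x *\<^sub>R f x"]) (use i in simp_all)
    then show ?thesis by (simp add: set_integrable_def ind)
  qed
  then show ?thesis by (simp add: locally_integrable_def)
qed

text \<open>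
  For a test function \<open>\<phi>\<close> put \<open>\<psi>(x) = \<phi>(B x)\<close>. Substituting \<open>x\<close> for \<open>A x\<close> moves the composition
  from \<open>f\<close> to \<open>\<phi>\<close>; the classical chain rule writes \<open>\<partial>\<^sub>i \<phi>\<close> through the \<open>\<partial>\<^sub>j \<psi>\<close> with the coefficients
  \<open>A\<^sub>j\<^sub>i\<close>, the weak derivatives of \<open>f\<close> are applied against \<open>\<psi>\<close>, and the same substitution is undone.
\<close>

lemma weak_gradient_matrix_compose:
  fixes A B :: "real^'n^'n"
  assumes inv: "A ** B = mat 1" "B ** A = mat 1" and wg: "weak_gradient f F"
  shows "weak_gradient (\<lambda>x. f (A *v x)) (\<lambda>x. transpose A *v F (A *v x))"
proof -
  obtain c where c: "c > 0" and D: "distr lborel borel ((*v) A) = density lborel (\<lambda>_. ennreal c)"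
    using distr_lborel_matrix[OF inv] by blast
  have f: "locally_integrable f" and F: "\<And>j. locally_integrable (\<lambda>x. F x $ j)"
    and ibp: "\<And>j p. test_function p \<Longrightarrow>
      (\<integral>x. f x * partial_deriv j p x \<partial>lborel) = - (\<integral>x. F x $ j * p x \<partial>lborel)"
    using wg by (auto simp: weak_gradient_def)
  have [measurable]: "f \<in> borel_measurable borel" "\<And>j. (\<lambda>x. F x $ j) \<in> borel_measurable borel"
    using f F by (auto simp: locally_integrable_def)
  have comp: "(transpose A *v v) $ i = (\<Sum>j\<in>UNIV. A $ j $ i * v $ j)" for v i
    by (simp add: matrix_vector_mult_def transpose_def del: transpose_matrix_vector)
  have "(\<integral>x. f (A *v x) * partial_deriv i \<phi> x \<partial>lborel) =
      - (\<integral>x. (transpose A *v F (A *v x)) $ i * \<phi> x \<partial>lborel)"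
    if \<phi>: "test_function \<phi>" for i \<phi>
  proof -
    define \<psi> where "\<psi> = (\<lambda>x. \<phi> (B *v x))"
    have \<psi>: "test_function \<psi>"
      unfolding \<psi>_def using inv \<phi> by (intro test_function_matrix_compose)
    have \<phi>_eq: "\<phi> = (\<lambda>x. \<psi> (A *v x))"
      by (simp add: \<psi>_def matrix_vector_mul_assoc inv)
    have diff: "\<psi> differentiable (at x)" for x
      using \<psi> times_cont_diff.simps(2)[of 0 \<psi>] unfolding test_function_def by blast
    have [measurable]: "\<psi> \<in> borel_measurable borel" "\<And>j. partial_deriv j \<psi> \<in> borel_measurable borel"
      using test_function_continuous[OF \<psi>] by (auto intro: borel_measurable_continuous_onI)
    have "(\<integral>x. f (A *v x) * partial_deriv i \<phi> x \<partial>lborel) =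
        (\<integral>x. f (A *v x) * (\<Sum>j\<in>UNIV. A $ j $ i * partial_deriv j \<psi> (A *v x)) \<partial>lborel)"
      by (simp add: \<phi>_eq partial_deriv_matrix_compose diff)
    also have "\<dots> = c * (\<integral>x. f x * (\<Sum>j\<in>UNIV. A $ j $ i * partial_deriv j \<psi> x) \<partial>lborel)"
      by (rule lborel_integral_linear_substitution(1)[OF D c]) measurable
    also have "\<dots> = c * (\<Sum>j\<in>UNIV. A $ j $ i * (\<integral>x. f x * partial_deriv j \<psi> x \<partial>lborel))"
      using integrable_weak_gradient_pairing(2)[OF f \<psi>]
      by (simp add: sum_distrib_left mult.left_commute[of "f _"] Bochner_Integration.integral_sum)
    also have "\<dots> = - (c * (\<Sum>j\<in>UNIV. A $ j $ i * (\<integral>x. F x $ j * \<psi> x \<partial>lborel)))"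
      by (simp add: ibp[OF \<psi>] sum_negf)
    also have "\<dots> = - (c * (\<integral>x. (\<Sum>j\<in>UNIV. A $ j $ i * F x $ j) * \<psi> x \<partial>lborel))"
      using integrable_weak_gradient_pairing(1)[OF F \<psi>]
      by (simp add: sum_distrib_right mult.assoc Bochner_Integration.integral_sum)
    also have "\<dots> = - (\<integral>x. (\<Sum>j\<in>UNIV. A $ j $ i * F (A *v x) $ j) * \<psi> (A *v x) \<partial>lborel)"
      by (subst lborel_integral_linear_substitution(1)[OF D c, symmetric]) measurable
    finally show ?thesis
      by (simp only: comp) (simp add: \<phi>_eq)
  qed
  moreover have "locally_integrable (\<lambda>x. (transpose A *v F (A *v x)) $ i)" for i
    unfolding comp by (intro locally_integrable_sum locally_integrable_matrix_compose[OF inv F])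
  ultimately show ?thesis
    using locally_integrable_matrix_compose[OF inv f] unfolding weak_gradient_def by blast
qed

section \<open>Poincare inequalities under linear maps\<close>

text \<open>
  The hypothesis on the energies is the pointwise form of the gradient's transformation rule: at
  \<open>A x\<close>, the energy of \<open>F\<close> is the energy at \<open>x\<close> of the gradient of the composed function.
\<close>

lemma poincare_ineq_linear_image:
  fixes A B :: "real^'n^'n"
  assumes inv: "A ** B = mat 1" "B ** A = mat 1"
    and [measurable_cong]: "sets M = sets borel"
    and P: "poincare_ineq M e C"
    and e: "\<And>x v. e' (A *v x) v = e x (transpose A *v v)"
  shows "poincare_ineq (distr M borel ((*v) A)) e' C"
  unfolding poincare_ineq_def
proof (intro allI impI, elim conjE)
  fix f F
  let ?N = "distr M borel ((*v) A)"
  assume f: "square_integrable ?N f" and wg: "weak_gradient f F"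
    and E: "integrable ?N (\<lambda>x. e' x (F x))"
  let ?f = "\<lambda>x. f (A *v x)" and ?F = "\<lambda>x. transpose A *v F (A *v x)"
  have [measurable]: "f \<in> borel_measurable borel" "(\<lambda>x. e' x (F x)) \<in> borel_measurable borel"
    using f borel_measurable_integrable[OF E] by (auto simp: square_integrable_def)
  have sq: "square_integrable M ?f"
    using f by (simp add: square_integrable_def integrable_distr_eq)
  have int: "integrable M (\<lambda>x. e x (?F x))"
    using E by (simp add: integrable_distr_eq e[symmetric] del: transpose_matrix_vector)
  have "Var ?N f = Var M ?f"
    by (simp add: Var_def integral_distr)
  also have "\<dots> \<le> C * (\<integral>x. e x (?F x) \<partial>M)"
    using P sq weak_gradient_matrix_compose[OF inv wg] int unfolding poincare_ineq_def by blast
  also have "(\<integral>x. e x (?F x) \<partial>M) = (\<integral>x. e' x (F x) \<partial>?N)"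
    by (simp add: integral_distr e[symmetric] del: transpose_matrix_vector)
  finally show "Var ?N f \<le> C * (\<integral>x. e' x (F x) \<partial>?N)" .
qed

text \<open>
  The radial weight \<open>w\<close> may take any value at \<open>0\<close>, even a negative one, for which the energies
  \<open>w r * \<parallel>v\<parallel>\<^sup>2\<close> and \<open>(sqrt (w r * \<parallel>v\<parallel>\<^sup>2))\<^sup>2\<close> differ. That single point carries no mass.
\<close>

lemma poincare_ineq_cong_off_origin:
  assumes "emeasure M {0} = 0" "{0} \<in> sets M" "\<And>x v. x \<noteq> 0 \<Longrightarrow> e x v = e' x v"
  shows "poincare_ineq M e C \<longleftrightarrow> poincare_ineq M e' C"
proof -
  have "integrable M (\<lambda>x. e x (F x)) \<longleftrightarrow> integrable M (\<lambda>x. e' x (F x))" for F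
    by (rule integrable_discrete_difference[where X = "{0}"]) (use assms in auto)
  moreover have "(\<integral>x. e x (F x) \<partial>M) = (\<integral>x. e' x (F x) \<partial>M)" for F
    by (rule integral_discrete_difference[where X = "{0}"]) (use assms in auto)
  ultimately show ?thesis by (simp add: poincare_ineq_def)
qed

lemma poincare_const_least:
  assumes ex: "\<exists>C. weighted_poincare M W C"
  shows "poincare_ineq M (\<lambda>x v. (mat_norm (W x) v)\<^sup>2) (poincare_const M W)"
    and "weighted_poincare M W C \<Longrightarrow> poincare_const M W \<le> C"
proof -
  let ?X = "{C. weighted_poincare M W C}"
  show "poincare_const M W \<le> C" if "weighted_poincare M W C"
    unfolding poincare_const_def
    by (rule cInf_lower) (use that in \<open>auto intro!: bdd_belowI[of _ 0] simp: weighted_poincare_def\<close>)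
  show "poincare_ineq M (\<lambda>x v. (mat_norm (W x) v)\<^sup>2) (poincare_const M W)"
    unfolding poincare_ineq_def
  proof (intro allI impI)
    fix f F
    let ?E = "\<integral>x. (mat_norm (W x) (F x))\<^sup>2 \<partial>M"
    assume *: "square_integrable M f \<and> weak_gradient f F \<and>
      integrable M (\<lambda>x. (mat_norm (W x) (F x))\<^sup>2)"
    then have le: "Var M f \<le> C * ?E" if "C \<in> ?X" for C
      using that unfolding weighted_poincare_def poincare_ineq_def by blast
    show "Var M f \<le> poincare_const M W * ?E"
      \<comment> \<open>Dividing the family of inequalities by the energy moves the infimum to the right-hand side;
        at zero energy all constants say the same.\<close>
    proof (cases "?E = 0")
      case True
      then show ?thesis using le ex by auto
    next
      case False
      then have "?E > 0" by (simp add: order_less_le)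
      then have "Var M f / ?E \<le> poincare_const M W"
        unfolding poincare_const_def using ex le
        by (intro cInf_greatest) (auto simp: divide_le_eq)
      with \<open>?E > 0\<close> show ?thesis by (simp add: divide_le_eq)
    qed
  qed
qed

section \<open>Elliptical distributions as linear images of spherical ones\<close>

text \<open>
  A Bochner integral defaults to \<open>0\<close> on non-integrable functions. This is how measurability of
  the profile \<open>x \<mapsto> g (\<parallel>x\<parallel>)\<close> is recovered from the normalization constant being nonzero.
\<close>

lemma borel_measurable_if_integral_nonzero:
  fixes h :: "'a::euclidean_space \<Rightarrow> real"
  assumes "(\<integral>x. h x \<partial>lborel) \<noteq> 0"
  shows "h \<in> borel_measurable borel"
proof -
  have "integrable lborel h"
    using assms not_integrable_integral_eq by blast
  then show ?thesis using borel_measurable_integrable by fastforce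
qed

lemma normalized_density_null_point: "emeasure (normalized_density h) {a} = 0"
proof (cases "(\<integral>y. h y \<partial>lborel) = 0")
  case True
  then show ?thesis by (simp add: normalized_density_def emeasure_density)
next
  case False
  then have [measurable]: "h \<in> borel_measurable borel"
    by (rule borel_measurable_if_integral_nonzero)
  have "{a} \<in> null_sets (density lborel (\<lambda>x. ennreal (h x / (\<integral>y. h y \<partial>lborel))))"
  proof (rule iffD2[OF null_sets_density_iff], measurable, intro conjI)
    show "AE x in lborel. x \<in> {a} \<longrightarrow> ennreal (h x / (\<integral>y. h y \<partial>lborel)) = 0"
      by (rule eventually_mono[OF AE_lborel_singleton[of a]]) simp
  qed simp
  then show ?thesis by (simp add: normalized_density_def null_sets_def)
qed

text \<open>
  The substitution multiplies the Lebesgue density and the normalization constant by the same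
  factor \<open>c\<close>, so normalized densities correspond exactly.
\<close>

lemma normalized_density_distr:
  fixes A B :: "real^'n^'n"
  assumes inv: "A ** B = mat 1" "B ** A = mat 1"
    and [measurable]: "h \<in> borel_measurable borel"
  shows "distr (normalized_density (\<lambda>x. h (A *v x))) borel ((*v) A) = normalized_density h"
proof -
  obtain c where c: "c > 0" and D: "distr lborel borel ((*v) A) = density lborel (\<lambda>_. ennreal c)"
    using distr_lborel_matrix[OF inv] by blast
  define Z where "Z = (\<integral>y. h y \<partial>lborel)"
  have Z: "(\<integral>y. h (A *v y) \<partial>lborel) = c * Z"
    unfolding Z_def by (rule lborel_integral_linear_substitution[OF D c]) simp
  have "distr (normalized_density (\<lambda>x. h (A *v x))) borel ((*v) A) =
      density (distr lborel borel ((*v) A)) (\<lambda>x. ennreal (h x / (c * Z)))"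
    unfolding normalized_density_def Z by (rule density_distr[symmetric]) measurable
  also have "\<dots> = density lborel (\<lambda>x. ennreal c * ennreal (h x / (c * Z)))"
    unfolding D by (rule density_density_eq) measurable
  also have "(\<lambda>x. ennreal c * ennreal (h x / (c * Z))) = (\<lambda>x. ennreal (h x / Z))"
    using c by (simp add: fun_eq_iff flip: ennreal_mult')
  finally show ?thesis by (simp add: normalized_density_def Z_def)
qed

theorem proposition4p1:
  fixes S :: "real^'n^'n" and g w :: "real \<Rightarrow> real"
  assumes "sym_pos_def S"
    and "\<And>i. S $ i $ i = 1"
    and "\<And>i j. i \<noteq> j \<Longrightarrow> S $ i $ j \<in> {-1<..<1}"
    and "\<And>r. r \<ge> 0 \<Longrightarrow> g r > 0"
    and "prob_space (elliptical g S)"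
    and "\<And>r. r > 0 \<Longrightarrow> w r > 0"
    and "w \<in> borel_measurable (restrict_space borel {0<..})"
    and "\<exists>C. weighted_poincare (spherical g :: (real^'n) measure)
                (\<lambda>x. w (norm x) *\<^sub>R mat 1) C"
  shows
    "let C\<^sub>P = poincare_const (spherical g :: (real^'n) measure) (\<lambda>x. w (norm x) *\<^sub>R mat 1);
         energy = (\<lambda>x v. w (mat_norm (matrix_inv S) x) * (mat_norm S v)\<^sup>2)
     in poincare_ineq (elliptical g S) energy C\<^sub>P \<and>
        (\<forall>C>0. poincare_ineq (elliptical g S) energy C \<longrightarrow> C\<^sub>P \<le> C)"
proof -
  obtain A B :: "real^'n^'n" where inv: "A ** B = mat 1" "B ** A = mat 1"
    and S: "S = A ** transpose A" and S': "matrix_inv S = transpose B ** B"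
    using sym_pos_def_factorization[OF assms(1)] by blast
  have BA [simp]: "B *v (A *v x) = x" and AB [simp]: "A *v (B *v x) = x" for x
    by (simp_all add: matrix_vector_mul_assoc inv)
  have gram: "((transpose T ** T) *v x) \<bullet> x = (norm (T *v x))\<^sup>2" for T :: "real^'n^'n" and x
    by (simp add: dot_lmul_matrix power2_norm_eq_inner flip: matrix_vector_mul_assoc)
  have mnS: "mat_norm S v = norm (transpose A *v v)" for v
    using gram[of "transpose A" v] by (simp add: mat_norm_def S)
  have mnS': "mat_norm (matrix_inv S) x = norm (B *v x)" for x
    using gram[of B x] by (simp add: mat_norm_def S')

  \<comment> \<open>On real square roots \<open>sqrt (- a) = - sqrt a\<close>, so squaring the weighted norm produces an
    absolute value around \<open>w\<close>. The energy \<open>ee\<close> is the exact transform of \<open>es\<close> under \<open>A\<close> and agrees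
    with the elliptical energy away from the origin.\<close>
  define es :: "real^'n \<Rightarrow> real^'n \<Rightarrow> real"
    where "es = (\<lambda>x v. (mat_norm (w (norm x) *\<^sub>R mat 1) v)\<^sup>2)"
  define ee :: "real^'n \<Rightarrow> real^'n \<Rightarrow> real"
    where "ee = (\<lambda>x v. \<bar>w (norm (B *v x))\<bar> * (norm (transpose A *v v))\<^sup>2)"
  define energy :: "real^'n \<Rightarrow> real^'n \<Rightarrow> real"
    where "energy = (\<lambda>x v. w (mat_norm (matrix_inv S) x) * (mat_norm S v)\<^sup>2)"
  have es: "es x v = \<bar>w (norm x)\<bar> * (norm v)\<^sup>2" for x v
  proof -
    have "((w (norm x) *\<^sub>R mat 1) *v v) \<bullet> v = w (norm x) * (norm v)\<^sup>2"
      by (simp add: power2_norm_eq_inner flip: scaleR_matrix_vector_assoc)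
    then show ?thesis
      by (simp add: es_def mat_norm_def real_sqrt_abs abs_mult flip: real_sqrt_power)
  qed
  have trans: "transpose A *v (transpose B *v v) = v" for v
    using inv by (simp add: matrix_vector_mul_assoc flip: matrix_transpose_mul
        del: transpose_matrix_vector)
  let ?E = "elliptical g S" and ?I = "spherical g :: (real^'n) measure"
  have off0: "poincare_ineq ?E energy C \<longleftrightarrow> poincare_ineq ?E ee C" for C
  proof (rule poincare_ineq_cong_off_origin)
    show "emeasure ?E {0} = 0" by (simp add: elliptical_def normalized_density_null_point)
    show "{0} \<in> sets ?E" by (simp add: elliptical_def normalized_density_def)
    fix x v :: "real^'n" assume "x \<noteq> 0"
    then have "B *v x \<noteq> 0" using AB[of x] by (metis matrix_vector_mult_0_right)
    then have "w (norm (B *v x)) > 0" using assms(6) by simp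
    then show "energy x v = ee x v" by (simp add: energy_def ee_def mnS mnS')
  qed

  define h :: "real^'n \<Rightarrow> real" where "h = (\<lambda>x. g (norm (B *v x)))"
  have E_eq: "?E = normalized_density h" by (simp add: elliptical_def h_def mnS')
  have "(\<integral>x. h x \<partial>lborel) \<noteq> 0"
  proof
    assume "(\<integral>x. h x \<partial>lborel) = 0"
    then have "emeasure ?E (space ?E) = 0"
      by (simp add: E_eq normalized_density_def emeasure_density)
    then show False using prob_space.emeasure_space_1[OF assms(5)] by simp
  qed
  then have h: "h \<in> borel_measurable borel"
    by (rule borel_measurable_if_integral_nonzero)
  have distr: "distr ?I borel ((*v) A) = ?E"
    using normalized_density_distr[OF inv h] by (simp add: E_eq spherical_def h_def)
  have sets_I [measurable_cong]: "sets ?I = sets borel"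
    by (simp add: spherical_def normalized_density_def)
  have sets_E [measurable_cong]: "sets ?E = sets borel"
    by (simp add: elliptical_def normalized_density_def)
  have "distr ?E borel ((*v) B) = distr ?I borel (\<lambda>x. B *v (A *v x))"
    unfolding distr[symmetric] by (simp add: distr_distr o_def)
  then have distr': "distr ?E borel ((*v) B) = ?I"
    by (simp add: distr_id2[OF sets_I[symmetric]])
  have iff: "poincare_ineq ?I es C \<longleftrightarrow> poincare_ineq ?E energy C" for C
  proof
    assume "poincare_ineq ?I es C"
    from poincare_ineq_linear_image[OF inv sets_I this, of ee]
    show "poincare_ineq ?E energy C"
      by (simp add: distr off0 es ee_def)
  next
    assume "poincare_ineq ?E energy C"
    then have "poincare_ineq ?E ee C" by (simp add: off0)
    from poincare_ineq_linear_image[OF inv(2,1) sets_E this, of es]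
    show "poincare_ineq ?I es C"
      by (simp add: distr' es ee_def trans del: transpose_matrix_vector)
  qed

  note least = poincare_const_least[OF assms(8), folded es_def]
  have "poincare_const ?I (\<lambda>x. w (norm x) *\<^sub>R mat 1) \<le> C"
    if "C > 0" "poincare_ineq ?E energy C" for C
    using that least(2) by (simp add: weighted_poincare_def iff flip: es_def)
  then show ?thesis
    using least(1) unfolding Let_def energy_def[symmetric] iff by blast
qed

end
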